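(* Let $\mathbb{K}$ be a field of characteristic $0$, and let $R$ be a $\mathbb{K}$-algebra whose center contains $\mathbb{K}[s]$. Let $q(s)\in\mathbb{K}[s]$ be a polynomial in one variable and let $I$ be a left ideal of $R$ satisfying $I\cap\mathbb{K}[s]\neq 0$. Then: (1) $\big(I+R\langle q(s)\rangle\big)\cap\mathbb{K}[s]=I\cap\mathbb{K}[s]+\mathbb{K}[s]\langle q(s)\rangle$; (2) $\big(I:q(s)\big)\cap\mathbb{K}[s]=\big(I\cap\mathbb{K}[s]\big):q(s)$; (3) $\big(I:q(s)^\infty\big)\cap\mathbb{K}[s]=\big(I\cap\mathbb{K}[s]\big):q(s)^\infty$. In particular, for a non-zero polynomial $f\in R_n=\mathbb{K}[x_1,\dots,x_n]$ with Bernstein-Sato polynomial $b_f(s)$, and any $q(s)\in\mathbb{K}[s]$: (a) $\big[\operatorname{Ann}_{D_n[s]}(f^s)+D_n[s]\langle f,q(s)\rangle\big]\cap\mathbb{K}[s]=\langle b_f(s),q(s)\rangle=\langle \gcd(b_f(s),q(s))\rangle$; (b) $\big[(\operatorname{Ann}_{D_n[s]}(f^s)+D_n[s]\langle f\rangle):q(s)\big]\cap\mathbb{K}[s]=\langle b_f(s)\rangle:q(s)=\Big\langle \frac{b_f(s)}{\gcd(b_f(s),q(s))}\Big\rangle$; (c) $\big[(\operatorname{Ann}_{D_n[s]}(f^s)+D_n[s]\langle f\rangle):q(s)^\infty\big]\cap\mathbb{K}[s]=\langle b_f(s)\rangle:q(s)^\infty$.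
   Context: Here $\mathbb{K}[s]$ is a polynomial ring in one variable. For a left ideal $I$ of a ring $R$ and a central element $q\in R$: $I:q=\{r\in R\mid qr\in I\}$ and $I:q^\infty=\bigcup_{j\ge 0}(I:q^j)$; likewise for ideals of $\mathbb{K}[s]$ (with $r\in\mathbb{K}[s]$). $R\langle q\rangle$ denotes the left ideal generated by $q$, and $D_n[s]\langle\dots\rangle$ the left ideal of $D_n[s]$ generated by the listed elements. $R_n=\mathbb{K}[x_1,\dots,x_n]$; $D_n$ is the $n$-th Weyl algebra, generated over $\mathbb{K}$ by $x_1,\dots,x_n,\partial_1,\dots,\partial_n$ with relations $\partial_i x_j=x_j\partial_i+\delta_{ij}$, $x_jx_i=x_ix_j$, $\partial_j\partial_i=\partial_i\partial_j$; $D_n[s]=D_n\otimes_{\mathbb{K}}\mathbb{K}[s]$ (so $s$ is central). For non-zero $f\in R_n$, $M=R_n[s,\frac1f]\cdot f^s$ is the free $R_n[s,\frac1f]$-module of rank one generated by the symbol $f^s$, made into a left $D_n[s]$-module by $\partial_i(g\cdot f^s)=\big(\frac{\partial g}{\partial x_i}+s\,g\,\frac{\partial f}{\partial x_i}\frac1f\big)\cdot f^s$. $\operatorname{Ann}_{D_n[s]}(f^s)$ is the left ideal of all $P(s)\in D_n[s]$ with $P(s)\cdot f^s=0$. The Bernstein-Sato polynomial $b_f(s)\in\mathbb{K}[s]$ is the monic polynomial of minimal degree for which there is $P(s)\in D_n[s]$ with $P(s)f\cdot f^s=b_f(s)\cdot f^s$ in $M$ (it exists by Bernstein's theorem); equivalently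 $\langle b_f(s)\rangle=(\operatorname{Ann}_{D_n[s]}(f^s)+D_n[s]\langle f\rangle)\cap\mathbb{K}[s]$. *)

theory Defs
  imports
    "HOL-Library.Poly_Mapping"
    "HOL-Library.Set_Algebras"
    "HOL-Computational_Algebra.Computational_Algebra"
begin

section \<open>Left ideals, quotients by an element, gcd\<close>

definition left_ideal :: "'a::ring_1 set \<Rightarrow> bool" where
  "left_ideal I \<longleftrightarrow> 0 \<in> I \<and> (\<forall>a\<in>I. \<forall>b\<in>I. a + b \<in> I) \<and> (\<forall>r. \<forall>a\<in>I. r * a \<in> I)"

definition left_ideal_gen :: "'a::ring_1 set \<Rightarrow> 'a set" where
  "left_ideal_gen S = left_ideal hull S"

definition ideal_quot :: "'a::ring_1 set \<Rightarrow> 'a \<Rightarrow> 'a set" where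
  "ideal_quot I q = {r. q * r \<in> I}"

definition ideal_sat :: "'a::ring_1 set \<Rightarrow> 'a \<Rightarrow> 'a set" where
  "ideal_sat I q = (\<Union>j. ideal_quot I (q ^ j))"

text \<open>
  \<open>central_embedding \<iota>\<close> makes \<open>'r\<close> a \<open>'k\<close>-algebra whose center contains (the isomorphic image
  under \<open>\<iota>\<close> of) the polynomial ring \<open>'k[s]\<close>; the algebra structure map is \<open>\<iota>\<close> on constants.
  The intersection of a set \<open>I\<close> with \<open>'k[s]\<close>, as a set of polynomials, is then \<open>\<iota> -` I\<close>.
\<close>

definition central_embedding :: "('k::field poly \<Rightarrow> 'r::ring_1) \<Rightarrow> bool" where
  "central_embedding \<iota> \<longleftrightarrow> inj \<iota> \<and> \<iota> 1 = 1 \<and>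
     (\<forall>p q. \<iota> (p + q) = \<iota> p + \<iota> q) \<and> (\<forall>p q. \<iota> (p * q) = \<iota> p * \<iota> q) \<and>
     (\<forall>p r. \<iota> p * r = r * \<iota> p)"

text \<open>
  The library's \<open>gcd\<close> on \<open>'k poly\<close> requires \<open>'k\<close> to be of class \<open>field_gcd\<close>, which not every type
  of class \<open>field\<close> is.  The following version (monic, or zero if both arguments vanish)
  works over every field; see \<open>field_poly_gcd_eq_gcd\<close> below.
\<close>

definition field_poly_gcd :: "'k::field poly \<Rightarrow> 'k poly \<Rightarrow> 'k poly" where
  "field_poly_gcd p q = (THE g. g dvd p \<and> g dvd q \<and> (\<forall>d. d dvd p \<longrightarrow> d dvd q \<longrightarrow> d dvd g) \<and>
     (g = 0 \<or> lead_coeff g = 1))"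

lemma field_poly_dvd_antisym:
  fixes g h :: "'k::field poly"
  assumes "g dvd h" "h dvd g" "g = 0 \<or> lead_coeff g = 1" "h = 0 \<or> lead_coeff h = 1"
  shows "g = h"
proof (cases "g = 0")
  case False
  with assms have "h \<noteq> 0" by auto
  with False assms have l: "lead_coeff g = 1" "lead_coeff h = 1" by auto
  from assms(1) obtain c where c: "h = g * c" by (elim dvdE)
  have "degree g = degree h"
    using assms(1,2) False \<open>h \<noteq> 0\<close> by (meson dvd_imp_degree_le le_antisym)
  then have "degree c = 0"
    using c False \<open>h \<noteq> 0\<close> by (simp add: degree_mult_eq)
  moreover have "lead_coeff c = 1"
    using c l by (simp add: lead_coeff_mult)
  ultimately have "c = 1"
    by (auto elim!: degree_eq_zeroE simp: one_pCons)
  with c show ?thesis by simp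
qed (use assms in auto)

lemma field_poly_gcd_ex:
  fixes p q :: "'k::field poly"
  shows "\<exists>g. g dvd p \<and> g dvd q \<and> (\<forall>d. d dvd p \<longrightarrow> d dvd q \<longrightarrow> d dvd g) \<and>
     (g = 0 \<or> lead_coeff g = 1)"
proof -
  have "\<exists>g. g dvd p \<and> g dvd q \<and> (\<forall>d. d dvd p \<longrightarrow> d dvd q \<longrightarrow> d dvd g)"
  proof (induction "euclidean_size q" arbitrary: p q rule: less_induct)
    case less
    show ?case
    proof (cases "q = 0")
      case True
      then show ?thesis by (intro exI[of _ p]) auto
    next
      case False
      then obtain g where g: "g dvd q" "g dvd p mod q"
        "\<forall>d. d dvd q \<longrightarrow> d dvd p mod q \<longrightarrow> d dvd g"
        using less[OF mod_size_less[OF False, of p], of q] by (elim exE conjE)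
      then show ?thesis
        by (intro exI[of _ g]) (auto simp: dvd_mod_iff dvd_mod)
    qed
  qed
  then obtain g where g: "g dvd p" "g dvd q" "\<forall>d. d dvd p \<longrightarrow> d dvd q \<longrightarrow> d dvd g"
    by blast
  show ?thesis
  proof (cases "g = 0")
    case False
    then show ?thesis
      using g by (intro exI[of _ "smult (inverse (lead_coeff g)) g"])
        (auto simp: smult_dvd_iff dvd_smult)
  qed (use g in auto)
qed

lemma field_poly_gcd:
  fixes p q :: "'k::field poly"
  shows "field_poly_gcd p q dvd p" "field_poly_gcd p q dvd q"
    "d dvd p \<Longrightarrow> d dvd q \<Longrightarrow> d dvd field_poly_gcd p q"
    "field_poly_gcd p q = 0 \<or> lead_coeff (field_poly_gcd p q) = 1"
proof -
  have "\<exists>!g. g dvd p \<and> g dvd q \<and> (\<forall>d. d dvd p \<longrightarrow> d dvd q \<longrightarrow> d dvd g) \<and>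
     (g = 0 \<or> lead_coeff g = 1)"
    using field_poly_gcd_ex[of p q] by (auto intro: field_poly_dvd_antisym)
  from theI'[OF this] show "field_poly_gcd p q dvd p" "field_poly_gcd p q dvd q"
    "d dvd p \<Longrightarrow> d dvd q \<Longrightarrow> d dvd field_poly_gcd p q"
    "field_poly_gcd p q = 0 \<or> lead_coeff (field_poly_gcd p q) = 1"
    unfolding field_poly_gcd_def by blast+
qed

lemma field_poly_gcd_eq_gcd:
  "field_poly_gcd p q = gcd p (q :: 'k::field_gcd poly)"
proof (rule field_poly_dvd_antisym)
  show "gcd p q = 0 \<or> lead_coeff (gcd p q) = 1"
  proof (cases "gcd p q = 0")
    case False
    have "normalize (gcd p q) = gcd p q" by simp
    then show ?thesis
      by (metis False coeff_normalize divide_self_if dvd_field_iff is_unit_unit_factor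
            leading_coeff_0_iff one_neq_zero)
  qed simp
qed (auto simp: field_poly_gcd)

section \<open>Polynomials and partial derivatives\<close>

text \<open>
  \<open>('n, 'k) mpol\<close> is the polynomial ring over \<open>'k\<close> in the variables indexed by \<open>'n\<close>, a map from
  exponent vectors to coefficients.  (A linear order on \<open>'n\<close> is what the library uses to show that
  it is an integral domain.)
\<close>

type_synonym ('n, 'k) mpol = "('n \<Rightarrow>\<^sub>0 nat) \<Rightarrow>\<^sub>0 'k"

abbreviation mvar :: "'n \<Rightarrow> ('n, 'k::comm_ring_1) mpol" where
  "mvar i \<equiv> Poly_Mapping.single (Poly_Mapping.single i 1) 1"

abbreviation mconst :: "'k::comm_ring_1 \<Rightarrow> ('n, 'k) mpol" where
  "mconst c \<equiv> Poly_Mapping.single 0 c"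

definition pd :: "'n \<Rightarrow> ('n, 'k::comm_ring_1) mpol \<Rightarrow> ('n, 'k) mpol" where
  "pd i p = (\<Sum>m\<in>Poly_Mapping.keys p.
     Poly_Mapping.single (m - Poly_Mapping.single i 1) (of_nat (Poly_Mapping.lookup m i) * Poly_Mapping.lookup p m))"

lemma pd_0 [simp]: "pd i 0 = 0"
  by (simp add: pd_def)

lemma pd_add: "pd i (p + q) = pd i p + pd i q"
  unfolding pd_def
  by (rule setsum_keys_plus_distrib) (simp_all add: algebra_simps single_add)

lemma pd_single:
  "pd i (Poly_Mapping.single m c) =
     Poly_Mapping.single (m - Poly_Mapping.single i 1) (of_nat (Poly_Mapping.lookup m i) * c)"
  by (simp add: pd_def)

lemma pd_const [simp]: "pd i (mconst c) = 0"
  by (simp add: pd_single)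

lemma pd_1 [simp]: "pd i 1 = 0"
  using pd_const[of i 1] by (simp del: pd_const)

lemma pd_mvar: "pd i (mvar j) = (if i = j then 1 else 0)"
  by (simp add: pd_single lookup_single when_def)

lemma poly_mapping_add_induct [case_names zero single add]:
  fixes p :: "'a \<Rightarrow>\<^sub>0 'b::comm_monoid_add"
  assumes "P 0" "\<And>m c. P (Poly_Mapping.single m c)" "\<And>p q. P p \<Longrightarrow> P q \<Longrightarrow> P (p + q)"
  shows "P p"
proof (induction p rule: update_induct)
  case (update f a b)
  have "Poly_Mapping.update a b f = Poly_Mapping.single a b + f"
    by (rule poly_mapping_eqI)
      (use update in \<open>auto simp: lookup_update lookup_add lookup_single when_def in_keys_iff\<close>)
  then show ?case using update assms by simp
qed (use assms in auto)

lemma pd_mult_single_aux: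
  fixes m m' :: "'n \<Rightarrow>\<^sub>0 nat"
  assumes "Poly_Mapping.lookup m i > 0"
  shows "m + m' - Poly_Mapping.single i 1 = m - Poly_Mapping.single i 1 + m'"
  by (rule poly_mapping_eqI) (use assms in \<open>auto simp: lookup_add lookup_minus lookup_single when_def\<close>)

lemma pd_mult_single:
  fixes a b :: "'k::comm_ring_1"
  shows "pd i (Poly_Mapping.single m a * Poly_Mapping.single m' b) =
    pd i (Poly_Mapping.single m a) * Poly_Mapping.single m' b +
    Poly_Mapping.single m a * pd i (Poly_Mapping.single m' b)"
proof -
  have 1: "Poly_Mapping.single (m + m' - Poly_Mapping.single i 1)
        (of_nat (Poly_Mapping.lookup m i) * (a * b)) =
      Poly_Mapping.single (m - Poly_Mapping.single i 1 + m')
        (of_nat (Poly_Mapping.lookup m i) * (a * b))"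
    using pd_mult_single_aux[of m i m'] by (cases "Poly_Mapping.lookup m i = 0") auto
  have 2: "Poly_Mapping.single (m + m' - Poly_Mapping.single i 1)
        (of_nat (Poly_Mapping.lookup m' i) * (a * b)) =
      Poly_Mapping.single (m + (m' - Poly_Mapping.single i 1))
        (of_nat (Poly_Mapping.lookup m' i) * (a * b))"
    using pd_mult_single_aux[of m' i m]
    by (cases "Poly_Mapping.lookup m' i = 0") (auto simp: add.commute)
  have "pd i (Poly_Mapping.single m a * Poly_Mapping.single m' b) =
     Poly_Mapping.single (m + m' - Poly_Mapping.single i 1)
        (of_nat (Poly_Mapping.lookup m i) * (a * b)) +
     Poly_Mapping.single (m + m' - Poly_Mapping.single i 1)
        (of_nat (Poly_Mapping.lookup m' i) * (a * b))"
    by (simp add: mult_single pd_single lookup_add single_add[symmetric] algebra_simps)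
  then show ?thesis
    unfolding 1 2 by (simp add: mult_single pd_single algebra_simps)
qed

lemma pd_mult: "pd i (p * q) = pd i p * q + p * pd i q"
proof (induction p rule: poly_mapping_add_induct)
  case (single m c)
  show ?case
  proof (induction q rule: poly_mapping_add_induct)
    case (single m' c')
    show ?case by (rule pd_mult_single)
  qed (simp_all add: pd_add algebra_simps)
qed (simp_all add: pd_add algebra_simps)

lemma pd_commute: "pd i (pd j p) = pd j (pd i p)"
proof (induction p rule: poly_mapping_add_induct)
  case (single m c)
  have "m - Poly_Mapping.single i 1 - Poly_Mapping.single j 1 =
      m - Poly_Mapping.single j 1 - Poly_Mapping.single i (1::nat)"
    by (simp add: diff_diff_add add.commute)
  then show ?case
    by (simp add: pd_single lookup_minus lookup_single when_def algebra_simps)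
qed (simp_all add: pd_add)

text \<open>The derivation \<open>\<partial>/\<partial>x\<^sub>i\<close> on \<open>R\<^sub>n[s]\<close>, with \<open>s\<close> constant, and on its field of fractions.\<close>

definition pds :: "'n \<Rightarrow> ('n, 'k::comm_ring_1) mpol poly \<Rightarrow> ('n, 'k) mpol poly" where
  "pds i = map_poly (pd i)"

lemma coeff_pds [simp]: "coeff (pds i p) k = pd i (coeff p k)"
  by (simp add: pds_def coeff_map_poly)

lemma pds_0 [simp]: "pds i 0 = 0"
  by (simp add: poly_eq_iff)

lemma pds_1 [simp]: "pds i 1 = 0"
  by (simp add: poly_eq_iff coeff_1)

lemma pds_add: "pds i (p + q) = pds i p + pds i q"
  by (simp add: poly_eq_iff pd_add)

lemma pds_pCons [simp]: "pds i (pCons a p) = pCons (pd i a) (pds i p)"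
  by (simp add: poly_eq_iff coeff_pCons split: nat.split)

lemma pd_sum: "pd i (\<Sum>x\<in>A. g x) = (\<Sum>x\<in>A. pd i (g x))"
  by (induction A rule: infinite_finite_induct) (simp_all add: pd_add)

lemma pds_mult: "pds i (p * q) = pds i p * q + p * pds i q"
  by (simp add: poly_eq_iff coeff_mult pd_sum pd_mult sum.distrib)

lemma pds_diff: "pds i (p - q) = pds i p - pds i q"
  using pds_add[of i "p - q" q] by (simp add: algebra_simps)

lemma pds_commute: "pds i (pds j p) = pds j (pds i p)"
  by (simp add: poly_eq_iff pd_commute[of i j])

type_synonym ('n, 'k) rfun = "('n, 'k) mpol poly fract"

definition fpd :: "'n::linorder \<Rightarrow> ('n, 'k::field) rfun \<Rightarrow> ('n, 'k) rfun" where
  "fpd i g = (THE h. \<exists>a b. b \<noteq> 0 \<and> g = Fract a b \<and>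
     h = Fract (pds i a * b - a * pds i b) (b * b))"

lemma fpd_Fract:
  assumes "b \<noteq> 0"
  shows "fpd i (Fract a b) = Fract (pds i a * b - a * pds i b) (b * b)"
  unfolding fpd_def
proof (rule the_equality)
  fix h assume "\<exists>c d. d \<noteq> 0 \<and> Fract a b = Fract c d \<and>
     h = Fract (pds i c * d - c * pds i d) (d * d)"
  then obtain c d where d: "d \<noteq> 0" and e: "a * d = c * b"
    and h: "h = Fract (pds i c * d - c * pds i d) (d * d)"
    using assms by (auto simp: eq_fract)
  have e': "pds i a * d + a * pds i d = pds i c * b + c * pds i b"
    using e by (metis pds_mult)
  have "(pds i c * d - c * pds i d) * (b * b) = (pds i a * b - a * pds i b) * (d * d)"
    using e e' by algebra
  then show "h = Fract (pds i a * b - a * pds i b) (b * b)"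
    using h assms d by (simp add: eq_fract)
qed (use assms in auto)

lemma fpd_to_fract [simp]: "fpd i (to_fract p) = to_fract (pds i p)"
  by (simp add: to_fract_def fpd_Fract)

lemma fpd_add: "fpd i (g + h) = fpd i g + fpd i h"
  by (cases g; cases h) (simp add: fpd_Fract eq_fract pds_add pds_mult algebra_simps)

lemma fpd_mult: "fpd i (g * h) = fpd i g * h + g * fpd i h"
  by (cases g; cases h) (simp add: fpd_Fract eq_fract pds_mult algebra_simps)

lemma fpd_0 [simp]: "fpd i 0 = 0"
  using fpd_to_fract[of i 0] by (simp del: fpd_to_fract)

lemma fpd_1 [simp]: "fpd i 1 = 0"
  using fpd_to_fract[of i 1] by (simp del: fpd_to_fract)

lemma fpd_commute: "fpd i (fpd j g) = fpd j (fpd i g)"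
  by (cases g) (simp add: fpd_Fract eq_fract pds_mult pds_diff pds_commute[of i j] algebra_simps)

section \<open>The Weyl algebra\<close>

text \<open>
  The free associative \<open>'k\<close>-algebra on the generators \<open>x\<^sub>i\<close>, \<open>\<partial>\<^sub>i\<close> is the monoid algebra of the
  monoid of words in these generators.
\<close>

datatype 'n weyl_gen = GX 'n | GD 'n

datatype 'n gen_word = Word (letters: "'n weyl_gen list")

instantiation gen_word :: (type) monoid_add
begin

definition "0 = Word []"

definition "v + w = Word (letters v @ letters w)"

instance
  by standard (simp_all add: zero_gen_word_def plus_gen_word_def)

end

type_synonym ('n, 'k) free_weyl = "'n gen_word \<Rightarrow>\<^sub>0 'k"

abbreviation fgen :: "'n weyl_gen \<Rightarrow> ('n, 'k::ring_1) free_weyl" where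
  "fgen a \<equiv> Poly_Mapping.single (Word [a]) 1"

text \<open>
  The congruence (of rings) generated by the defining relations of the Weyl algebra.  It is
  compatible with the action of constants since these are elements of the free algebra.
\<close>

inductive weyl_rel :: "('n, 'k::field) free_weyl \<Rightarrow> ('n, 'k) free_weyl \<Rightarrow> bool" where
  rel_dx: "weyl_rel (fgen (GD i) * fgen (GX j)) (fgen (GX j) * fgen (GD i) + (if i = j then 1 else 0))"
| rel_xx: "weyl_rel (fgen (GX j) * fgen (GX i)) (fgen (GX i) * fgen (GX j))"
| rel_dd: "weyl_rel (fgen (GD j) * fgen (GD i)) (fgen (GD i) * fgen (GD j))"
| refl: "weyl_rel p p"
| sym: "weyl_rel p q \<Longrightarrow> weyl_rel q p"
| trans: "weyl_rel p q \<Longrightarrow> weyl_rel q r \<Longrightarrow> weyl_rel p r"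
| add: "weyl_rel p q \<Longrightarrow> weyl_rel p' q' \<Longrightarrow> weyl_rel (p + p') (q + q')"
| mult: "weyl_rel p q \<Longrightarrow> weyl_rel p' q' \<Longrightarrow> weyl_rel (p * p') (q * q')"

text \<open>
  The element \<open>g \<cdot> f\<^sup>s\<close> of \<open>M = R\<^sub>n[s, 1/f] \<cdot> f\<^sup>s\<close> is represented by its coefficient \<open>g\<close>, and the
  localization \<open>R\<^sub>n[s, 1/f]\<close> is regarded as a subring of the field of fractions of \<open>R\<^sub>n[s]\<close>
  (\<open>fs_module f\<close> below).  The action is defined by the same formulas on the whole of
  \<open>Frac(R\<^sub>n[s]) \<cdot> f\<^sup>s\<close>; by lemma \<open>ds_act_in_fs_module\<close> it restricts to \<open>M\<close>.
\<close>

abbreviation rconst :: "'k \<Rightarrow> ('n::linorder, 'k::field) rfun" where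
  "rconst c \<equiv> to_fract [:mconst c:]"

abbreviation rpoly :: "('n, 'k) mpol \<Rightarrow> ('n::linorder, 'k::field) rfun" where
  "rpoly p \<equiv> to_fract [:p:]"

abbreviation rs :: "('n::linorder, 'k::field) rfun" where
  "rs \<equiv> to_fract [:0, 1:]"

fun gen_act :: "('n, 'k) mpol \<Rightarrow> 'n weyl_gen \<Rightarrow> ('n, 'k) rfun \<Rightarrow> ('n::linorder, 'k::field) rfun" where
  "gen_act f (GX i) g = rpoly (mvar i) * g"
| "gen_act f (GD i) g = fpd i g + rs * g * rpoly (pd i f) * (1 / rpoly f)"

definition word_act :: "('n, 'k) mpol \<Rightarrow> 'n gen_word \<Rightarrow> ('n, 'k) rfun \<Rightarrow> ('n::linorder, 'k::field) rfun" where
  "word_act f w g = foldr (gen_act f) (letters w) g"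

definition free_act :: "('n, 'k) mpol \<Rightarrow> ('n, 'k) free_weyl \<Rightarrow> ('n, 'k) rfun \<Rightarrow> ('n::linorder, 'k::field) rfun" where
  "free_act f p g = (\<Sum>w\<in>Poly_Mapping.keys p. rconst (Poly_Mapping.lookup p w) * word_act f w g)"

lemma word_act_0 [simp]: "word_act f 0 g = g"
  by (simp add: word_act_def zero_gen_word_def)

lemma word_act_plus: "word_act f (v + w) g = word_act f v (word_act f w g)"
  by (simp add: word_act_def plus_gen_word_def)

lemma fpd_rconst [simp]: "fpd i (rconst c) = 0"
  by simp

lemma gen_act_add: "gen_act f a (g + h) = gen_act f a g + gen_act f a h"
  by (cases a) (simp_all add: fpd_add algebra_simps)

lemma gen_act_scale: "gen_act f a (rconst c * g) = rconst c * gen_act f a g"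
proof (cases a)
  case (GD i)
  then show ?thesis
    using fpd_mult[of i "rconst c" g] by (simp only: gen_act.simps fpd_rconst) (simp add: algebra_simps)
qed (simp add: algebra_simps)

lemma gen_act_scale_s: "gen_act f a (rs * g) = rs * gen_act f a g"
proof (cases a)
  case (GD i)
  then show ?thesis
    using fpd_mult[of i rs g] by (simp add: algebra_simps)
qed (simp add: algebra_simps)

lemma word_act_add: "word_act f w (g + h) = word_act f w g + word_act f w h"
proof -
  have "foldr (gen_act f) as (g + h) = foldr (gen_act f) as g + foldr (gen_act f) as h" for as
    by (induction as) (simp_all add: gen_act_add)
  then show ?thesis by (simp add: word_act_def)
qed

lemma word_act_scale: "word_act f w (rconst c * g) = rconst c * word_act f w g"
proof -
  have "foldr (gen_act f) as (rconst c * g) = rconst c * foldr (gen_act f) as g" for as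
    by (induction as) (simp_all only: foldr.simps comp_def id_def gen_act_scale)
  then show ?thesis by (simp only: word_act_def)
qed

lemma word_act_scale_s: "word_act f w (rs * g) = rs * word_act f w g"
proof -
  have "foldr (gen_act f) as (rs * g) = rs * foldr (gen_act f) as g" for as
    by (induction as) (simp_all only: foldr.simps comp_def id_def gen_act_scale_s)
  then show ?thesis by (simp only: word_act_def)
qed

lemma rconst_0 [simp]: "rconst 0 = 0"
  by simp

lemma rpoly_0: "rpoly 0 = 0"
  by simp

lemma to_fract_power: "to_fract (p ^ k) = to_fract p ^ k"
  by (induction k) simp_all

lemma rconst_1: "rconst 1 = 1"
  by (simp flip: one_pCons)

lemma rconst_add: "rconst (c + d) = rconst c + rconst d"
  by (simp add: single_add flip: to_fract_add)

lemma rconst_mult: "rconst (c * d) = rconst c * rconst d"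
  by (simp add: mult_single mult.commute flip: to_fract_mult)

lemma free_act_0 [simp]: "free_act f 0 g = 0"
  by (simp add: free_act_def)

lemma free_act_single: "free_act f (Poly_Mapping.single w c) g = rconst c * word_act f w g"
  by (simp add: free_act_def)

lemma free_act_add: "free_act f (p + q) g = free_act f p g + free_act f q g"
  unfolding free_act_def
  by (rule setsum_keys_plus_distrib) (simp_all only: rconst_0 rconst_add algebra_simps mult_zero_left)

lemma free_act_add_right: "free_act f p (g + h) = free_act f p g + free_act f p h"
  by (simp add: free_act_def word_act_add algebra_simps sum.distrib)

lemma free_act_scale: "free_act f p (rconst c * g) = rconst c * free_act f p g"
  unfolding free_act_def word_act_scale sum_distrib_left
  by (simp only: mult.left_commute)

lemma free_act_scale_s: "free_act f p (rs * g) = rs * free_act f p g"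
  unfolding free_act_def word_act_scale_s sum_distrib_left
  by (simp only: mult.left_commute)

lemma free_act_0_right [simp]: "free_act f p 0 = 0"
  using free_act_scale[of f p 0 0] by (simp only: rconst_0 mult_zero_left)

lemma free_act_1 [simp]: "free_act f 1 g = g"
proof -
  have "free_act f 1 g = free_act f (Poly_Mapping.single 0 1) g" by simp
  also have "\<dots> = g" by (simp only: free_act_single rconst_1 word_act_0 mult_1_left)
  finally show ?thesis .
qed

lemma free_act_mult: "free_act f (p * q) g = free_act f p (free_act f q g)"
proof (induction p rule: poly_mapping_add_induct)
  case (single w c)
  show ?case
  proof (induction q rule: poly_mapping_add_induct)
    case (single w' c')
    show ?case
      by (simp only: mult_single free_act_single word_act_plus word_act_scale rconst_mult mult.assoc)
  qed (simp_all add: distrib_left free_act_add free_act_add_right)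
qed (simp_all add: distrib_right free_act_add)

lemma free_act_fgen: "free_act f (fgen a) g = gen_act f a g"
  by (simp only: free_act_single rconst_1) (simp add: word_act_def)

lemma gen_act_dx:
  "gen_act f (GD i) (gen_act f (GX j) g) =
   gen_act f (GX j) (gen_act f (GD i) g) + (if i = j then g else 0)"
proof -
  have "fpd i (rpoly (mvar j) * g) = (if i = j then 1 else 0) * g + rpoly (mvar j) * fpd i g"
    unfolding fpd_mult fpd_to_fract pds_pCons pds_0 pd_mvar
    by (simp flip: one_pCons)
  then show ?thesis by (simp add: algebra_simps)
qed

lemma fpd_inverse: "fpd i (1 / rpoly f) = - (rpoly (pd i f) * (1 / rpoly f) * (1 / rpoly f))"
proof (cases "f = 0")
  case False
  define F where "F = rpoly f"
  have "F \<noteq> 0" using False by (simp add: F_def)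
  have fF: "fpd i F = rpoly (pd i f)" by (simp add: F_def)
  have "fpd i (F * (1 / F)) = 0"
    using \<open>F \<noteq> 0\<close> by simp
  then have "F * fpd i (1 / F) = - (rpoly (pd i f) * (1 / F))"
    unfolding fpd_mult fF by (simp add: eq_neg_iff_add_eq_0 add.commute)
  then have "(1 / F) * (F * fpd i (1 / F)) = - (rpoly (pd i f) * (1 / F) * (1 / F))"
    by simp
  then show ?thesis using \<open>F \<noteq> 0\<close> by (simp add: F_def)
qed simp

lemma log_deriv_commute:
  "fpd i (rpoly (pd j f) * (1 / rpoly f)) = fpd j (rpoly (pd i f) * (1 / rpoly f))"
  unfolding fpd_mult fpd_inverse by (simp add: pd_commute[of i j] algebra_simps)

lemma gen_act_dd:
  "gen_act f (GD i) (gen_act f (GD j) g) = gen_act f (GD j) (gen_act f (GD i) g)"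
proof -
  define u where "u k = rpoly (pd k f) * (1 / rpoly f)" for k
  have ga: "gen_act f (GD k) h = fpd k h + rs * h * u k" for k h
    by (simp add: u_def)
  have u: "fpd i (u j) = fpd j (u i)"
    unfolding u_def by (rule log_deriv_commute)
  have s: "fpd k rs = 0" for k by simp
  show ?thesis
    unfolding ga fpd_add fpd_mult s u fpd_commute[of i j] by (simp add: algebra_simps)
qed

lemma free_act_cong: "weyl_rel p q \<Longrightarrow> free_act f p g = free_act f q g"
proof (induction arbitrary: g rule: weyl_rel.induct)
  case (rel_dx i j)
  show ?case
    by (simp only: free_act_mult free_act_add free_act_fgen gen_act_dx) simp
next
  case (rel_xx j i)
  show ?case by (simp add: free_act_mult free_act_fgen)
next
  case (rel_dd j i)
  show ?case by (simp only: free_act_mult free_act_fgen gen_act_dd[of f j i])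
qed (simp_all add: free_act_add free_act_mult)

quotient_type (overloaded) ('n, 'k) weyl = "('n, 'k::field) free_weyl" / weyl_rel
  by (intro equivpI reflpI sympI transpI) (blast intro: weyl_rel.refl weyl_rel.sym weyl_rel.trans)+

instantiation weyl :: (linorder, field) ring_1
begin

lift_definition zero_weyl :: "('a, 'b) weyl" is 0 .

lift_definition one_weyl :: "('a, 'b) weyl" is 1 .

lift_definition plus_weyl :: "('a, 'b) weyl \<Rightarrow> ('a, 'b) weyl \<Rightarrow> ('a, 'b) weyl" is "(+)"
  by (rule weyl_rel.add)

lift_definition times_weyl :: "('a, 'b) weyl \<Rightarrow> ('a, 'b) weyl \<Rightarrow> ('a, 'b) weyl" is "(*)"
  by (rule weyl_rel.mult)

lift_definition uminus_weyl :: "('a, 'b) weyl \<Rightarrow> ('a, 'b) weyl" is uminus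
  using weyl_rel.mult[OF weyl_rel.refl[of "-1"]] by simp

lift_definition minus_weyl :: "('a, 'b) weyl \<Rightarrow> ('a, 'b) weyl \<Rightarrow> ('a, 'b) weyl" is "(-)"
proof -
  fix p p' q q' :: "('a, 'b) free_weyl"
  assume "weyl_rel p p'" "weyl_rel q q'"
  then have "weyl_rel (p + (-1) * q) (p' + (-1) * q')"
    by (intro weyl_rel.add weyl_rel.mult weyl_rel.refl)
  then show "weyl_rel (p - q) (p' - q')" by simp
qed

instance
proof
  show "(0::('a, 'b) weyl) \<noteq> 1"
  proof (transfer, rule notI)
    assume "weyl_rel (0::('a, 'b) free_weyl) 1"
    from free_act_cong[OF this, of 0 1] show False by simp
  qed
qed (transfer; simp add: weyl_rel.refl algebra_simps)+

end

lift_definition weyl_act :: "('n, 'k) mpol \<Rightarrow> ('n, 'k) weyl \<Rightarrow> ('n, 'k) rfun \<Rightarrow> ('n::linorder, 'k::field) rfun"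
  is free_act
  by (rule ext) (rule free_act_cong)

lift_definition weyl_const :: "'k::field \<Rightarrow> ('n::linorder, 'k) weyl" is
  "\<lambda>c. Poly_Mapping.single 0 c" .

lift_definition weyl_x :: "'n::linorder \<Rightarrow> ('n, 'k::field) weyl" is "\<lambda>i. fgen (GX i)" .

lift_definition weyl_d :: "'n::linorder \<Rightarrow> ('n, 'k::field) weyl" is "\<lambda>i. fgen (GD i)" .

lemma weyl_rel_dx_eq: "weyl_rel (fgen (GD i) * fgen (GX i)) (fgen (GX i) * fgen (GD i) + 1)"
  using weyl_rel.rel_dx[of i i] unfolding if_P[OF HOL.refl] .

lemma weyl_rel_dx_neq:
  assumes "i \<noteq> j"
  shows "weyl_rel (fgen (GD i) * fgen (GX j)) (fgen (GX j) * fgen (GD i))"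
  using weyl_rel.rel_dx[of i j] unfolding if_not_P[OF assms] add_0_right .

lemma weyl_d_x: "weyl_d i * weyl_x j = weyl_x j * weyl_d i + (if i = j then 1 else 0)"
proof (cases "i = j")
  case True
  have "weyl_d i * weyl_x i = weyl_x i * weyl_d i + 1"
    by transfer (rule weyl_rel_dx_eq)
  with True show ?thesis by simp
next
  case False
  then have "weyl_d i * weyl_x j = weyl_x j * weyl_d i"
    by transfer (rule weyl_rel_dx_neq)
  with False show ?thesis by simp
qed

lemma weyl_x_x: "weyl_x i * weyl_x j = weyl_x j * weyl_x i"
  by transfer (rule weyl_rel.rel_xx)

lemma weyl_d_d: "weyl_d i * weyl_d j = weyl_d j * weyl_d i"
  by transfer (rule weyl_rel.rel_dd)

lemma weyl_act_simps:
  "weyl_act f 0 g = 0" "weyl_act f 1 g = g"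
  "weyl_act f (P + Q) g = weyl_act f P g + weyl_act f Q g"
  "weyl_act f (P * Q) g = weyl_act f P (weyl_act f Q g)"
  "weyl_act f P 0 = 0" "weyl_act f P (g + h) = weyl_act f P g + weyl_act f P h"
  "weyl_act f P (rs * g) = rs * weyl_act f P g"
  "weyl_act f (weyl_const c) g = rconst c * g"
  "weyl_act f (weyl_x i) g = rpoly (mvar i) * g"
  "weyl_act f (weyl_d i) g = fpd i g + rs * g * rpoly (pd i f) * (1 / rpoly f)"
proof -
  note E = weyl_act.abs_eq zero_weyl.abs_eq one_weyl.abs_eq plus_weyl.abs_eq times_weyl.abs_eq
    weyl_const.abs_eq weyl_x.abs_eq weyl_d.abs_eq
  obtain p where p: "P = abs_weyl p" by (induction P rule: weyl.abs_induct) blast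
  obtain q where q: "Q = abs_weyl q" by (induction Q rule: weyl.abs_induct) blast
  show "weyl_act f 0 g = 0" "weyl_act f 1 g = g"
    "weyl_act f (P + Q) g = weyl_act f P g + weyl_act f Q g"
    "weyl_act f (P * Q) g = weyl_act f P (weyl_act f Q g)"
    "weyl_act f P 0 = 0" "weyl_act f P (g + h) = weyl_act f P g + weyl_act f P h"
    "weyl_act f P (rs * g) = rs * weyl_act f P g"
    "weyl_act f (weyl_const c) g = rconst c * g"
    "weyl_act f (weyl_x i) g = rpoly (mvar i) * g"
    "weyl_act f (weyl_d i) g = fpd i g + rs * g * rpoly (pd i f) * (1 / rpoly f)"
    unfolding p q E
    by (simp_all only: free_act_0 free_act_1 free_act_add free_act_mult free_act_0_right
        free_act_add_right free_act_scale_s free_act_single word_act_0 free_act_fgen gen_act.simps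
        rconst_1) (simp_all add: word_act_def)
qed

section \<open>The ring \<open>D\<^sub>n[s]\<close> and its action\<close>

text \<open>
  \<open>D\<^sub>n[s] = D\<^sub>n \<otimes> 'k[s]\<close> is the ring of polynomials in the central variable \<open>s\<close> over the
  non-commutative ring \<open>D\<^sub>n\<close>; a value maps \<open>j\<close> to the coefficient of \<open>s\<^sup>j\<close>.
\<close>

type_synonym ('n, 'k) weyl_s = "nat \<Rightarrow>\<^sub>0 ('n, 'k) weyl"

definition ds_act :: "('n, 'k) mpol \<Rightarrow> ('n, 'k) weyl_s \<Rightarrow> ('n, 'k) rfun \<Rightarrow> ('n::linorder, 'k::field) rfun" where
  "ds_act f P g = (\<Sum>j\<in>Poly_Mapping.keys P. rs ^ j * weyl_act f (Poly_Mapping.lookup P j) g)"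

text \<open>
  The embeddings of \<open>'k[s]\<close> and of \<open>R\<^sub>n\<close> into \<open>D\<^sub>n[s]\<close>; see \<open>central_embedding_ds_upoly\<close> and
  \<open>ds_act_ds_mpol\<close>.
\<close>

definition ds_upoly :: "'k poly \<Rightarrow> ('n::linorder, 'k::field) weyl_s" where
  "ds_upoly q = (\<Sum>j\<le>degree q. Poly_Mapping.single j (weyl_const (coeff q j)))"

definition weyl_monom :: "('n \<Rightarrow>\<^sub>0 nat) \<Rightarrow> ('n::linorder, 'k::field) weyl" where
  "weyl_monom m =
     prod_list (map (\<lambda>i. weyl_x i ^ Poly_Mapping.lookup m i) (sorted_list_of_set (Poly_Mapping.keys m)))"

definition ds_mpol :: "('n, 'k) mpol \<Rightarrow> ('n::linorder, 'k::field) weyl_s" where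
  "ds_mpol p = Poly_Mapping.single 0
     (\<Sum>m\<in>Poly_Mapping.keys p. weyl_const (Poly_Mapping.lookup p m) * weyl_monom m)"

lemma ds_act_0 [simp]: "ds_act f 0 g = 0"
  by (simp add: ds_act_def)

lemma ds_act_single: "ds_act f (Poly_Mapping.single j P) g = rs ^ j * weyl_act f P g"
  by (simp add: ds_act_def weyl_act_simps(1))

lemma ds_act_1 [simp]: "ds_act f 1 g = g"
proof -
  have "ds_act f 1 g = ds_act f (Poly_Mapping.single 0 1) g" by simp
  also have "\<dots> = g" by (simp only: ds_act_single weyl_act_simps power_0 mult_1_left)
  finally show ?thesis .
qed

lemma ds_act_add: "ds_act f (P + Q) g = ds_act f P g + ds_act f Q g"
  unfolding ds_act_def
  by (rule setsum_keys_plus_distrib) (simp_all only: weyl_act_simps distrib_left mult_zero_right)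

lemma ds_act_add_right: "ds_act f P (g + h) = ds_act f P g + ds_act f P h"
  by (simp add: ds_act_def weyl_act_simps(6) distrib_left sum.distrib)

lemma weyl_act_scale_s_power: "weyl_act f P (rs ^ j * g) = rs ^ j * weyl_act f P g"
  by (induction j) (simp_all only: power_0 power_Suc mult_1_left mult.assoc weyl_act_simps(7))

lemma ds_act_0_right [simp]: "ds_act f P 0 = 0"
  by (simp add: ds_act_def weyl_act_simps(5))

lemma ds_act_mult: "ds_act f (P * Q) g = ds_act f P (ds_act f Q g)"
proof (induction P rule: poly_mapping_add_induct)
  case (single j A)
  show ?case
  proof (induction Q rule: poly_mapping_add_induct)
    case (single k B)
    show ?case
      by (simp only: mult_single ds_act_single weyl_act_simps(4) weyl_act_scale_s_power power_add mult.assoc)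
  qed (simp_all add: distrib_left ds_act_add ds_act_add_right)
qed (simp_all add: distrib_right ds_act_add)

lemma ds_act_uminus: "ds_act f (- P) g = - ds_act f P g"
  using ds_act_add[of f P "- P" g] by (simp add: eq_neg_iff_add_eq_0 add.commute)

lemma weyl_const_0 [simp]: "weyl_const 0 = 0"
  by transfer (simp add: weyl_rel.refl)

lemma weyl_const_1 [simp]: "weyl_const 1 = 1"
  by transfer (simp add: weyl_rel.refl)

lemma weyl_const_add: "weyl_const (a + b) = weyl_const a + weyl_const b"
  by transfer (simp add: weyl_rel.refl single_add)

lemma weyl_const_mult: "weyl_const (a * b) = weyl_const a * weyl_const b"
  by transfer (simp add: weyl_rel.refl mult_single)

lemma free_const_central:
  "Poly_Mapping.single 0 c * p = p * Poly_Mapping.single (0::'a::monoid_add) (c::'k::comm_ring_1)"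
  by (induction p rule: poly_mapping_add_induct)
    (simp_all add: mult_single mult.commute distrib_left distrib_right)

lemma weyl_const_central: "weyl_const c * P = P * weyl_const c"
  by transfer (simp only: free_const_central weyl_rel.refl)

lemma lookup_ds_upoly: "Poly_Mapping.lookup (ds_upoly q) j = weyl_const (coeff q j)"
proof -
  have "Poly_Mapping.lookup (ds_upoly q) j =
      (\<Sum>k\<le>degree q. if k = j then weyl_const (coeff q k) else 0)"
    by (simp add: ds_upoly_def lookup_sum lookup_single when_def)
  also have "\<dots> = weyl_const (coeff q j)"
    by (simp add: sum.delta coeff_eq_0)
  finally show ?thesis .
qed

lemma ds_upoly_add: "ds_upoly (p + q) = ds_upoly p + ds_upoly q"
  by (rule poly_mapping_eqI) (simp add: lookup_ds_upoly lookup_add weyl_const_add)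

lemma ds_upoly_0 [simp]: "ds_upoly 0 = 0"
  by (rule poly_mapping_eqI) (simp add: lookup_ds_upoly)

lemma ds_upoly_1 [simp]: "ds_upoly 1 = 1"
  by (rule poly_mapping_eqI) (simp add: lookup_ds_upoly lookup_one when_def coeff_1)

lemma ds_single_0_mult: "Poly_Mapping.lookup (Poly_Mapping.single 0 A * Q) j = A * Poly_Mapping.lookup Q (j::nat)"
  for A :: "'a::ring_1"
  by (induction Q rule: poly_mapping_add_induct)
    (auto simp: mult_single lookup_single when_def distrib_left lookup_add)

lemma ds_single_1_mult:
  "Poly_Mapping.lookup (Poly_Mapping.single 1 1 * Q) j =
     (case j of 0 \<Rightarrow> 0 | Suc i \<Rightarrow> Poly_Mapping.lookup Q i)"
  for Q :: "nat \<Rightarrow>\<^sub>0 'a::ring_1"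
  by (induction Q rule: poly_mapping_add_induct)
    (auto simp: mult_single lookup_single when_def distrib_left lookup_add split: nat.split)

lemma ds_upoly_pCons:
  "ds_upoly (pCons a p) = Poly_Mapping.single 0 (weyl_const a) + Poly_Mapping.single 1 1 * ds_upoly p"
  by (rule poly_mapping_eqI, unfold lookup_add ds_single_1_mult)
    (auto simp: lookup_ds_upoly coeff_pCons lookup_single when_def split: nat.split)

lemma ds_upoly_smult: "ds_upoly (smult a p) = Poly_Mapping.single 0 (weyl_const a) * ds_upoly p"
  by (rule poly_mapping_eqI) (simp add: lookup_ds_upoly ds_single_0_mult weyl_const_mult)

lemma ds_upoly_mult: "ds_upoly (p * q) = ds_upoly p * ds_upoly q"
proof (induction p)
  case (pCons a p)
  then show ?case
    by (simp add: ds_upoly_add ds_upoly_smult ds_upoly_pCons[of a] ds_upoly_pCons[of 0 "p * q"]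
        distrib_right mult.assoc)
qed simp

lemma ds_single_const_central:
  "Poly_Mapping.single j (weyl_const c) * P = P * Poly_Mapping.single (j::nat) (weyl_const c)"
  by (induction P rule: poly_mapping_add_induct)
    (simp_all add: mult_single weyl_const_central add.commute distrib_left distrib_right)

lemma ds_upoly_central: "ds_upoly p * P = P * ds_upoly p"
  unfolding ds_upoly_def sum_distrib_left sum_distrib_right ds_single_const_central ..

lemma ds_act_ds_upoly: "ds_act f (ds_upoly q) g = to_fract (map_poly mconst q) * g"
proof (induction q arbitrary: g)
  case (pCons a q)
  have "ds_act f (ds_upoly (pCons a q)) g = rconst a * g + rs * (to_fract (map_poly mconst q) * g)"
    unfolding ds_upoly_pCons ds_act_add ds_act_mult pCons.IH ds_act_single weyl_act_simps
    by simp
  also have "\<dots> = (rconst a + rs * to_fract (map_poly mconst q)) * g"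
    by (simp add: algebra_simps)
  also have "rconst a + rs * to_fract (map_poly mconst q) = to_fract (map_poly mconst (pCons a q))"
    by (subst map_poly_pCons) (simp_all flip: to_fract_add to_fract_mult)
  finally show ?case .
qed simp

lemma ds_upoly_inj: "inj (ds_upoly :: 'k poly \<Rightarrow> ('n::linorder, 'k::field) weyl_s)"
proof (rule injI)
  fix p q :: "'k poly"
  assume "(ds_upoly p :: ('n, 'k) weyl_s) = ds_upoly q"
  then have "ds_act (0 :: ('n, 'k) mpol) (ds_upoly p) 1 = ds_act 0 (ds_upoly q) 1"
    by simp
  then have *: "map_poly mconst p = (map_poly mconst q :: ('n, 'k) mpol poly)"
    by (simp add: ds_act_ds_upoly)
  show "p = q"
  proof (rule poly_eqI)
    fix j
    have "mconst (coeff p j) = (mconst (coeff q j) :: ('n, 'k) mpol)"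
      using arg_cong[OF *, of "\<lambda>r. coeff r j"] by (simp add: coeff_map_poly)
    then show "coeff p j = coeff q j"
      by (metis lookup_single_eq)
  qed
qed

lemma central_embedding_ds_upoly: "central_embedding (ds_upoly :: 'k::field poly \<Rightarrow> ('n::linorder, 'k) weyl_s)"
  unfolding central_embedding_def
  using ds_upoly_inj ds_upoly_1 ds_upoly_add ds_upoly_mult ds_upoly_central by blast

lemma weyl_act_x_power: "weyl_act f (weyl_x i ^ k) g = rpoly (mvar i ^ k) * g"
proof (induction k)
  case 0
  show ?case by (simp add: weyl_act_simps flip: one_pCons)
next
  case (Suc k)
  have "rpoly (mvar i ^ Suc k) = rpoly (mvar i) * (rpoly (mvar i ^ k) :: ('a, 'b) rfun)"
    by (simp flip: to_fract_mult)
  then show ?case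
    by (simp only: power_Suc weyl_act_simps Suc mult.assoc)
qed

lemma mvar_power: "mvar i ^ k = Poly_Mapping.single (Poly_Mapping.single i k) 1"
  by (induction k) (simp_all add: mult_single single_add[symmetric])

lemma weyl_act_monom: "weyl_act f (weyl_monom m) g = rpoly (Poly_Mapping.single m 1) * g"
proof -
  have *: "weyl_act f (prod_list (map (\<lambda>i. weyl_x i ^ Poly_Mapping.lookup m i) is)) g =
      rpoly (Poly_Mapping.single (\<Sum>i\<leftarrow>is. Poly_Mapping.single i (Poly_Mapping.lookup m i)) 1) * g" for "is"
  proof (induction "is")
    case Nil
    show ?case by (simp add: weyl_act_simps flip: one_pCons)
  next
    case (Cons i "is")
    show ?case
      by (simp only: list.map prod_list.Cons sum_list.Cons weyl_act_simps Cons weyl_act_x_power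
          mvar_power mult.assoc[symmetric] to_fract_mult[symmetric])
        (simp add: mult_single add.commute)
  qed
  have "(\<Sum>i\<leftarrow>sorted_list_of_set (Poly_Mapping.keys m). Poly_Mapping.single i (Poly_Mapping.lookup m i)) = m"
    (is "?s = m")
  proof (rule poly_mapping_eqI)
    fix j
    have "?s = (\<Sum>i\<in>Poly_Mapping.keys m. Poly_Mapping.single i (Poly_Mapping.lookup m i))"
      by (simp add: sum_list_distinct_conv_sum_set)
    then show "Poly_Mapping.lookup ?s j = Poly_Mapping.lookup m j"
      by (simp add: lookup_sum lookup_single when_def sum.delta in_keys_iff)
  qed
  then show ?thesis using * by (simp add: weyl_monom_def)
qed

lemma weyl_act_sum: "weyl_act f (\<Sum>x\<in>A. P x) g = (\<Sum>x\<in>A. weyl_act f (P x) g)"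
  by (induction A rule: infinite_finite_induct) (simp_all add: weyl_act_simps)

lemma rpoly_add: "rpoly (p + q) = rpoly p + rpoly q"
  by (simp flip: to_fract_add)

lemma rpoly_sum: "rpoly (\<Sum>x\<in>A. p x) = (\<Sum>x\<in>A. rpoly (p x))"
  by (induction A rule: infinite_finite_induct) (simp_all add: rpoly_add)

lemma mpol_eq_sum: "(\<Sum>m\<in>Poly_Mapping.keys p. Poly_Mapping.single m (Poly_Mapping.lookup p m)) = p"
  for p :: "'a \<Rightarrow>\<^sub>0 'b::comm_monoid_add"
  by (rule poly_mapping_eqI) (simp add: lookup_sum lookup_single when_def sum.delta in_keys_iff)

lemma ds_act_ds_mpol: "ds_act f (ds_mpol p) g = rpoly p * g"
proof -
  have 1: "rconst c * rpoly (Poly_Mapping.single m 1) = rpoly (Poly_Mapping.single m c)"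
    for c :: 'b and m :: "'a \<Rightarrow>\<^sub>0 nat"
    by (simp add: mult_single flip: to_fract_mult)
  have "ds_act f (ds_mpol p) g =
      (\<Sum>m\<in>Poly_Mapping.keys p. rconst (Poly_Mapping.lookup p m) * rpoly (Poly_Mapping.single m 1)) * g"
    by (simp add: ds_mpol_def ds_act_single weyl_act_sum weyl_act_simps weyl_act_monom
        sum_distrib_right mult.assoc)
  also have "\<dots> = rpoly p * g"
    unfolding 1 rpoly_sum[symmetric] mpol_eq_sum ..
  finally show ?thesis .
qed

section \<open>The module \<open>R\<^sub>n[s, 1/f] \<cdot> f\<^sup>s\<close>\<close>

definition fs_module :: "('n, 'k) mpol \<Rightarrow> ('n::linorder, 'k::field) rfun set" where
  "fs_module f = {to_fract a * (1 / rpoly f) ^ k |a k. True}"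

lemma one_in_fs_module: "1 \<in> fs_module f"
  unfolding fs_module_def by (auto intro!: exI[of _ 1] exI[of _ "0::nat"])

lemma fs_module_cases:
  assumes "g \<in> fs_module f"
  obtains a k where "g = to_fract a * (1 / rpoly f) ^ k"
  using assms unfolding fs_module_def by blast

lemma fs_module_mult: "g \<in> fs_module f \<Longrightarrow> h \<in> fs_module f \<Longrightarrow> g * h \<in> fs_module f"
proof (elim fs_module_cases)
  fix a b k l
  assume "g = to_fract a * (1 / rpoly f) ^ k" "h = to_fract b * (1 / rpoly f) ^ l"
  then have "g * h = to_fract (a * b) * (1 / rpoly f) ^ (k + l)"
    by (simp add: power_add algebra_simps)
  then show ?thesis unfolding fs_module_def by blast
qed

lemma to_fract_in_fs_module: "to_fract a \<in> fs_module f"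
  unfolding fs_module_def by (auto intro!: exI[of _ a] exI[of _ "0::nat"])

lemma inverse_in_fs_module: "1 / rpoly f \<in> fs_module f"
  unfolding fs_module_def mem_Collect_eq by (rule exI[of _ 1], rule exI[of _ 1]) simp

lemma fs_module_add:
  assumes "f \<noteq> 0" "g \<in> fs_module f" "h \<in> fs_module f"
  shows "g + h \<in> fs_module f"
  using assms(2,3)
proof (elim fs_module_cases)
  fix a b k l
  assume g: "g = to_fract a * (1 / rpoly f) ^ k" and h: "h = to_fract b * (1 / rpoly f) ^ l"
  define F where "F = rpoly f"
  have F: "F \<noteq> 0" using assms(1) by (simp add: F_def)
  have "g + h = (to_fract a * F ^ l + to_fract b * F ^ k) * (1 / F) ^ (k + l)"
    using F unfolding g h F_def[symmetric] by (simp add: field_simps power_add)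
  also have "to_fract a * F ^ l + to_fract b * F ^ k = to_fract (a * [:f:] ^ l + b * [:f:] ^ k)"
    unfolding F_def by (simp add: to_fract_power)
  finally show ?thesis unfolding fs_module_def F_def by blast
qed

lemma fs_module_uminus: "g \<in> fs_module f \<Longrightarrow> - g \<in> fs_module f"
  using fs_module_mult[OF to_fract_in_fs_module[of "-1"]] by simp

lemma fs_module_fpd:
  assumes "f \<noteq> 0" "g \<in> fs_module f"
  shows "fpd i g \<in> fs_module f"
proof -
  note closed = to_fract_in_fs_module inverse_in_fs_module fs_module_mult fs_module_uminus
    fs_module_add[OF assms(1)]
  have pow: "(1 / rpoly f) ^ k \<in> fs_module f" for k
    by (induction k) (auto simp only: power_0 power_Suc one_in_fs_module intro!: closed)
  have pd_pow: "fpd i ((1 / rpoly f) ^ k) \<in> fs_module f" for k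
  proof (induction k)
    case 0
    show ?case using to_fract_in_fs_module[of 0 f] by simp
  next
    case (Suc k)
    then show ?case
      unfolding power_Suc fpd_mult fpd_inverse by (intro closed pow)
  qed
  from assms(2) obtain a k where "g = to_fract a * (1 / rpoly f) ^ k"
    by (rule fs_module_cases)
  then show ?thesis
    using pow pd_pow by (simp only: fpd_mult fpd_to_fract) (intro closed)
qed

lemma ds_act_in_fs_module:
  assumes "f \<noteq> 0" "g \<in> fs_module f"
  shows "ds_act f P g \<in> fs_module f"
proof -
  note closed = to_fract_in_fs_module inverse_in_fs_module fs_module_mult fs_module_uminus
    fs_module_add[OF assms(1)] fs_module_fpd[OF assms(1)]
  have sum: "(\<And>x. x \<in> A \<Longrightarrow> h x \<in> fs_module f) \<Longrightarrow> sum h A \<in> fs_module f" for h :: "'c \<Rightarrow> _" and A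
    using to_fract_in_fs_module[of 0 f]
    by (induction A rule: infinite_finite_induct) (auto intro: closed)
  have gen: "gen_act f a h \<in> fs_module f" if "h \<in> fs_module f" for a h
    using that by (cases a) (simp_all only: gen_act.simps, (intro closed; assumption)+)
  have word: "word_act f w g \<in> fs_module f" for w
  proof -
    have "foldr (gen_act f) as g \<in> fs_module f" for as
      by (induction as) (auto simp only: foldr.simps comp_def id_def intro: gen assms(2))
    then show ?thesis by (simp only: word_act_def)
  qed
  have free: "free_act f p g \<in> fs_module f" for p
    unfolding free_act_def by (intro sum closed word)
  have weyl: "weyl_act f A g \<in> fs_module f" for A
    by (induction A rule: weyl.abs_induct) (simp only: weyl_act.abs_eq free)
  show ?thesis
    unfolding ds_act_def to_fract_power[symmetric] by (intro sum closed weyl)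
qed

section \<open>Annihilator and Bernstein-Sato polynomial\<close>

text \<open>The generator \<open>f\<^sup>s\<close> of the module is represented by the coefficient \<open>1\<close>.\<close>

definition ann_fs :: "('n, 'k) mpol \<Rightarrow> ('n::linorder, 'k::field) weyl_s set" where
  "ann_fs f = {P. ds_act f P 1 = 0}"

definition bs_relation :: "('n::linorder, 'k::field) mpol \<Rightarrow> 'k poly \<Rightarrow> bool" where
  "bs_relation f b \<longleftrightarrow> (\<exists>P. ds_act f (P * ds_mpol f) 1 = ds_act f (ds_upoly b) 1)"

definition is_bernstein_sato :: "('n::linorder, 'k::field) mpol \<Rightarrow> 'k poly \<Rightarrow> bool" where
  "is_bernstein_sato f b \<longleftrightarrow> lead_coeff b = 1 \<and> bs_relation f b \<and>
     (\<forall>c. lead_coeff c = 1 \<and> bs_relation f c \<longrightarrow> degree b \<le> degree c)"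

lemma bs_relation_mult: "bs_relation f b \<Longrightarrow> bs_relation f (c * b)"
proof -
  assume "bs_relation f b"
  then obtain P where P: "ds_act f (P * ds_mpol f) 1 = ds_act f (ds_upoly b) 1"
    by (auto simp: bs_relation_def)
  have "ds_act f ((ds_upoly c * P) * ds_mpol f) 1 = ds_act f (ds_upoly (c * b)) 1"
    unfolding ds_upoly_mult mult.assoc ds_act_mult[of f "ds_upoly c"] P ..
  then show ?thesis unfolding bs_relation_def by blast
qed

lemma bs_relation_add: "bs_relation f b \<Longrightarrow> bs_relation f c \<Longrightarrow> bs_relation f (b + c)"
proof -
  assume "bs_relation f b" "bs_relation f c"
  then obtain P Q where P: "ds_act f (P * ds_mpol f) 1 = ds_act f (ds_upoly b) 1"
    "ds_act f (Q * ds_mpol f) 1 = ds_act f (ds_upoly c) 1"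
    by (auto simp: bs_relation_def)
  have "ds_act f ((P + Q) * ds_mpol f) 1 = ds_act f (ds_upoly (b + c)) 1"
    unfolding distrib_right ds_upoly_add ds_act_add P ..
  then show ?thesis unfolding bs_relation_def by blast
qed

text \<open>There is at most one Bernstein-Sato polynomial of \<open>f\<close>.\<close>

lemma is_bernstein_sato_unique:
  assumes "is_bernstein_sato f b" "is_bernstein_sato f c"
  shows "b = c"
proof (rule ccontr)
  assume "b \<noteq> c"
  define d where "d = b - c"
  define e where "e = [:inverse (lead_coeff d):] * d"
  have d0: "d \<noteq> 0" using \<open>b \<noteq> c\<close> by (simp add: d_def)
  have deg: "degree b = degree c"
    using assms unfolding is_bernstein_sato_def by (meson le_antisym)
  have l: "lead_coeff b = 1" "lead_coeff c = 1"
    and r: "bs_relation f b" "bs_relation f c"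
    using assms by (auto simp: is_bernstein_sato_def)
  have "bs_relation f (b + (-1) * c)"
    by (intro bs_relation_add bs_relation_mult r)
  then have "bs_relation f e"
    unfolding e_def by (intro bs_relation_mult) (simp add: d_def)
  moreover have "lead_coeff e = 1"
    using d0 by (simp add: e_def)
  ultimately have "degree b \<le> degree e"
    using assms(1) by (simp add: is_bernstein_sato_def)
  also have "degree e = degree d"
    using d0 by (simp add: e_def)
  finally have "degree b \<le> degree d" .
  moreover have "degree d \<le> degree b"
    using deg by (simp add: d_def degree_diff_le)
  ultimately have "coeff d (degree b) \<noteq> 0"
    using d0 by (metis le_antisym leading_coeff_0_iff)
  then show False
    using l deg by (simp add: d_def)
qed

end

theory Submission
  imports Defs
begin

text \<open>
  The substance of the theorem is the inclusion
  \<open>(I + R\<langle>q\<rangle>) \<inter> \<K>[s] \<subseteq> (I \<inter> \<K>[s]) + \<langle>q\<rangle>\<close>; the converse is clear, and the statements on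
  quotients and saturations only say that multiplication by \<open>q\<close> can be carried out in \<open>\<K>[s]\<close> or
  in \<open>R\<close>.  Since \<open>\<K>[s]\<close> is a principal ideal domain, \<open>I \<inter> \<K>[s] = \<langle>h\<rangle>\<close>, where \<open>h \<noteq> 0\<close> by
  hypothesis.  Let \<open>g = gcd(h, q)\<close>, \<open>h = g u\<close> and \<open>q = g v\<close>.  If a polynomial \<open>p\<close> can be written
  as \<open>i + r q\<close> with \<open>i \<in> I\<close> and \<open>r \<in> R\<close>, then \<open>u p = u i + r (u q) = u i + (r v) h \<in> I\<close>,
  because \<open>u\<close> is central and \<open>u q = v h\<close>.  So \<open>h = g u\<close> divides \<open>u p\<close>, and as \<open>u \<noteq> 0\<close>, \<open>g\<close>
  divides \<open>p\<close>, which means \<open>p \<in> \<langle>h, q\<rangle> = (I \<inter> \<K>[s]) + \<langle>q\<rangle>\<close>.  This is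
  \<open>vimage_plus_left_ideal_gen\<close>.

  The part on Bernstein-Sato polynomials is the case \<open>R = D\<^sub>n[s]\<close> and
  \<open>I = Ann(f\<^sup>s) + D\<^sub>n[s]\<langle>f\<rangle>\<close>.  A polynomial \<open>p\<close> lies in this \<open>I\<close> if and only if
  \<open>P f \<cdot> f\<^sup>s = p \<cdot> f\<^sup>s\<close> for some \<open>P\<close>, so \<open>I \<inter> \<K>[s] = \<langle>b\<^sub>f\<rangle>\<close> by the minimality of the degree
  of \<open>b\<^sub>f\<close> (\<open>vimage_bernstein_ideal\<close>).  The remaining equalities, which express the ideals of
  \<open>\<K>[s]\<close> through the gcd, follow from Bezout's identity.
\<close>

section \<open>Left ideals and their generators\<close>

lemma left_idealD:
  assumes "left_ideal I"
  shows left_ideal_zero: "0 \<in> I"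
    and left_ideal_add: "a \<in> I \<Longrightarrow> b \<in> I \<Longrightarrow> a + b \<in> I"
    and left_ideal_mult: "a \<in> I \<Longrightarrow> r * a \<in> I"
  using assms by (auto simp: left_ideal_def)

lemma left_ideal_diff:
  assumes "left_ideal I" "a \<in> I" "b \<in> I"
  shows "a - b \<in> I"
  using left_ideal_add[OF assms(1,2) left_ideal_mult[OF assms(1,3), of "-1"]] by simp

lemma left_ideal_set_plus:
  assumes "left_ideal I" "left_ideal J"
  shows "left_ideal (I + J)"
  unfolding left_ideal_def
proof (intro conjI ballI allI)
  show "0 \<in> I + J"
    using set_plus_intro[OF left_ideal_zero left_ideal_zero, OF assms] by simp
next
  fix x y assume "x \<in> I + J" "y \<in> I + J"
  then obtain a b c d where xy: "x = a + b" "y = c + d"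
    and mem: "a \<in> I" "b \<in> J" "c \<in> I" "d \<in> J"
    by (elim set_plus_elim)
  have "(a + c) + (b + d) \<in> I + J"
    by (intro set_plus_intro left_ideal_add assms mem)
  then show "x + y \<in> I + J"
    by (simp add: xy algebra_simps)
next
  fix r x assume "x \<in> I + J"
  then obtain a b where x: "x = a + b" and mem: "a \<in> I" "b \<in> J"
    by (elim set_plus_elim)
  have "r * a + r * b \<in> I + J"
    by (intro set_plus_intro left_ideal_mult assms mem)
  then show "r * x \<in> I + J"
    by (simp add: x distrib_left)
qed

lemma left_ideal_left_ideal_gen: "left_ideal (left_ideal_gen S)"
  unfolding left_ideal_gen_def by (rule hull_in) (auto simp: left_ideal_def)

lemma left_ideal_gen_superset: "S \<subseteq> left_ideal_gen S"
  unfolding left_ideal_gen_def by (rule hull_subset)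

lemma left_ideal_gen_minimal: "S \<subseteq> I \<Longrightarrow> left_ideal I \<Longrightarrow> left_ideal_gen S \<subseteq> I"
  unfolding left_ideal_gen_def by (rule hull_minimal)

lemma left_ideal_gen_mono: "S \<subseteq> T \<Longrightarrow> left_ideal_gen S \<subseteq> left_ideal_gen T"
  unfolding left_ideal_gen_def by (rule hull_mono)

lemma left_ideal_gen_Un: "left_ideal_gen (S \<union> T) = left_ideal_gen S + left_ideal_gen T"
proof
  note zero = left_ideal_zero[OF left_ideal_left_ideal_gen]
  show "left_ideal_gen (S \<union> T) \<subseteq> left_ideal_gen S + left_ideal_gen T"
  proof (rule left_ideal_gen_minimal)
    have "S \<subseteq> left_ideal_gen S + left_ideal_gen T"
      using left_ideal_gen_superset[of S] set_plus_intro[OF _ zero[of T], of _ "left_ideal_gen S"]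
      by auto
    moreover have "T \<subseteq> left_ideal_gen S + left_ideal_gen T"
      using left_ideal_gen_superset[of T] set_plus_intro[OF zero[of S], of _ "left_ideal_gen T"]
      by auto
    ultimately show "S \<union> T \<subseteq> left_ideal_gen S + left_ideal_gen T"
      by simp
  qed (intro left_ideal_set_plus left_ideal_left_ideal_gen)
  show "left_ideal_gen S + left_ideal_gen T \<subseteq> left_ideal_gen (S \<union> T)"
  proof
    fix x assume "x \<in> left_ideal_gen S + left_ideal_gen T"
    then obtain a b where x: "x = a + b" and "a \<in> left_ideal_gen S" "b \<in> left_ideal_gen T"
      by (elim set_plus_elim)
    then have "a \<in> left_ideal_gen (S \<union> T)" "b \<in> left_ideal_gen (S \<union> T)"
      using left_ideal_gen_mono[of S "S \<union> T"] left_ideal_gen_mono[of T "S \<union> T"] by auto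
    then show "x \<in> left_ideal_gen (S \<union> T)"
      unfolding x by (rule left_ideal_add[OF left_ideal_left_ideal_gen])
  qed
qed

lemma left_ideal_gen_pair: "left_ideal_gen {a, b} = left_ideal_gen {a} + left_ideal_gen {b}"
  unfolding insert_is_Un[of a "{b}"] by (rule left_ideal_gen_Un)

lemma left_ideal_gen_singleton: "left_ideal_gen {a} = range (\<lambda>r. r * a)"
proof
  have "left_ideal (range (\<lambda>r. r * a))"
    unfolding left_ideal_def
    by (auto simp: image_iff simp flip: distrib_right mult.assoc intro: exI[of _ 0])
  moreover have "a \<in> range (\<lambda>r. r * a)"
    by (rule range_eqI[of _ _ 1]) simp
  ultimately show "left_ideal_gen {a} \<subseteq> range (\<lambda>r. r * a)"
    by (intro left_ideal_gen_minimal) auto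
  show "range (\<lambda>r. r * a) \<subseteq> left_ideal_gen {a}"
    using left_ideal_gen_superset[of "{a}"] left_ideal_mult[OF left_ideal_left_ideal_gen] by auto
qed

section \<open>Ideals of the polynomial ring in one variable\<close>

lemma mem_left_ideal_gen_singleton_iff_dvd:
  "p \<in> left_ideal_gen {h} \<longleftrightarrow> h dvd (p :: 'a::comm_ring_1)"
  unfolding left_ideal_gen_singleton by (auto simp: dvd_def image_iff mult.commute)

lemma left_ideal_eq_gen_of_min_degree:
  fixes h :: "'k::field poly"
  assumes J: "left_ideal J" and h: "h \<in> J" "h \<noteq> 0"
    and min: "\<And>p. p \<in> J \<Longrightarrow> p \<noteq> 0 \<Longrightarrow> degree h \<le> degree p"
  shows "J = left_ideal_gen {h}"
proof
  show "left_ideal_gen {h} \<subseteq> J"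
    using h J by (intro left_ideal_gen_minimal) auto
  show "J \<subseteq> left_ideal_gen {h}"
  proof
    fix p assume "p \<in> J"
    then have "p - (p div h) * h \<in> J"
      by (intro left_ideal_diff left_ideal_mult J h)
    then have "p mod h \<in> J"
      by (simp add: minus_div_mult_eq_mod)
    then have "p mod h = 0"
      using min[of "p mod h"] degree_mod_less'[OF h(2), of p] by fastforce
    then show "p \<in> left_ideal_gen {h}"
      by (simp add: mem_left_ideal_gen_singleton_iff_dvd dvd_eq_mod_eq_0)
  qed
qed

lemma poly_ideal_principal:
  fixes J :: "'k::field poly set"
  assumes J: "left_ideal J"
  obtains h where "J = left_ideal_gen {h}"
proof (cases "J = {0}")
  case True
  then have "J = left_ideal_gen {0}"
    by (auto simp: left_ideal_gen_singleton)
  then show ?thesis by (rule that)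
next
  case False
  then obtain p where "p \<in> J \<and> p \<noteq> 0"
    using left_ideal_zero[OF J] by blast
  then show ?thesis
    using left_ideal_eq_gen_of_min_degree[OF J] that ex_has_least_nat[of "\<lambda>p. p \<in> J \<and> p \<noteq> 0" p degree]
    by metis
qed

text \<open>
  Bezout's identity: the generator of \<open>\<langle>p, q\<rangle>\<close> divides \<open>p\<close> and \<open>q\<close>, and every common divisor of
  \<open>p\<close> and \<open>q\<close> divides all elements of \<open>\<langle>p, q\<rangle>\<close>.
\<close>

lemma left_ideal_gen_pair_eq_gcd:
  fixes p q :: "'k::field poly"
  shows "left_ideal_gen {p, q} = left_ideal_gen {field_poly_gcd p q}"
proof -
  obtain h where h: "left_ideal_gen {p, q} = left_ideal_gen {h}"
    using poly_ideal_principal[OF left_ideal_left_ideal_gen] .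
  have "p \<in> left_ideal_gen {h}" "q \<in> left_ideal_gen {h}"
    using left_ideal_gen_superset[of "{p, q}"] by (auto simp: h)
  then have "h dvd field_poly_gcd p q"
    by (simp add: mem_left_ideal_gen_singleton_iff_dvd field_poly_gcd(3))
  then have "left_ideal_gen {field_poly_gcd p q} \<subseteq> left_ideal_gen {h}"
    by (intro left_ideal_gen_minimal left_ideal_left_ideal_gen)
      (simp add: mem_left_ideal_gen_singleton_iff_dvd)
  moreover have "left_ideal_gen {p, q} \<subseteq> left_ideal_gen {field_poly_gcd p q}"
    by (intro left_ideal_gen_minimal left_ideal_left_ideal_gen)
      (simp add: mem_left_ideal_gen_singleton_iff_dvd field_poly_gcd(1,2))
  ultimately show ?thesis
    unfolding h by (intro equalityI)
qed

text \<open>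
  Cancelling \<open>g = gcd(b, q)\<close> from \<open>b dvd q r\<close> leaves \<open>b / g dvd (q / g) r\<close>, and \<open>b / g\<close> is coprime
  to \<open>q / g\<close>.
\<close>

lemma ideal_quot_principal:
  fixes b q :: "'k::field poly"
  assumes "b \<noteq> 0"
  shows "ideal_quot (left_ideal_gen {b}) q = left_ideal_gen {b div field_poly_gcd b q}"
proof -
  define g where "g = field_poly_gcd b q"
  obtain u v where u: "b = g * u" and v: "q = g * v"
    using field_poly_gcd(1,2)[of b q, folded g_def] by (elim dvdE)
  have g0: "g \<noteq> 0" using u assms by auto
  have "g \<in> left_ideal_gen {b, q}"
    by (simp add: left_ideal_gen_pair_eq_gcd g_def mem_left_ideal_gen_singleton_iff_dvd)
  then obtain x y where xy: "g = x * b + y * q"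
    by (auto simp: left_ideal_gen_pair left_ideal_gen_singleton elim!: set_plus_elim)
  have "g * (x * u + y * v) = x * b + y * q"
    unfolding u v by (simp add: algebra_simps)
  then have "g * (x * u + y * v) = g * 1"
    unfolding xy[symmetric] by simp
  then have bezout: "x * u + y * v = 1"
    using g0 by (metis mult_cancel_left)
  have "b dvd q * r \<longleftrightarrow> u dvd r" for r
  proof
    assume "b dvd q * r"
    then have "u dvd v * r"
      using g0 by (simp add: u v mult.assoc)
    then have "u dvd u * (x * r) + y * (v * r)"
      by simp
    also have "u * (x * r) + y * (v * r) = (x * u + y * v) * r"
      by (simp add: algebra_simps)
    finally show "u dvd r"
      by (simp add: bezout)
  next
    assume "u dvd r"
    then show "b dvd q * r"
      unfolding u v mult.assoc by (intro mult_dvd_mono dvd_mult dvd_refl)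
  qed
  moreover have "b div g = u"
    unfolding u by (rule nonzero_mult_div_cancel_left[OF g0])
  ultimately show ?thesis
    by (simp only: ideal_quot_def set_eq_iff mem_Collect_eq mem_left_ideal_gen_singleton_iff_dvd
        flip: g_def) simp
qed

section \<open>Intersection with a central polynomial ring\<close>

context
  fixes \<iota> :: "'k::field poly \<Rightarrow> 'r::ring_1"
  assumes \<iota>: "central_embedding \<iota>"
begin

lemma central_embedding_add: "\<iota> (p + q) = \<iota> p + \<iota> q"
  and central_embedding_mult: "\<iota> (p * q) = \<iota> p * \<iota> q"
  and central_embedding_1: "\<iota> 1 = 1"
  and central_embedding_commute: "\<iota> p * r = r * \<iota> p"
  using \<iota> unfolding central_embedding_def by blast+

lemma central_embedding_0: "\<iota> 0 = 0"
  using central_embedding_add[of 0 0] by simp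

lemma central_embedding_power: "\<iota> (p ^ j) = \<iota> p ^ j"
  by (induction j) (simp_all add: central_embedding_1 central_embedding_mult)

lemma left_ideal_vimage: "left_ideal I \<Longrightarrow> left_ideal (\<iota> -` I)"
  by (simp add: left_ideal_def central_embedding_0 central_embedding_add central_embedding_mult)

lemma vimage_ideal_quot: "\<iota> -` ideal_quot I (\<iota> q) = ideal_quot (\<iota> -` I) q"
  by (simp add: ideal_quot_def central_embedding_mult)

lemma vimage_ideal_sat: "\<iota> -` ideal_sat I (\<iota> q) = ideal_sat (\<iota> -` I) q"
  by (simp add: ideal_sat_def vimage_UN flip: vimage_ideal_quot central_embedding_power)

text \<open>
  Multiplying \<open>p \<in> I + R\<langle>q\<rangle>\<close> by \<open>u = h / gcd(h, q)\<close>, where \<open>h\<close> generates the intersection of \<open>I\<close>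
  with \<open>\<K>[s]\<close>, moves it into that intersection; the factor \<open>u\<close> can be cancelled because \<open>h \<noteq> 0\<close>.
\<close>

lemma vimage_plus_left_ideal_gen:
  assumes I: "left_ideal I" and nonzero: "\<iota> -` I \<noteq> {0}"
  shows "\<iota> -` (I + left_ideal_gen {\<iota> q}) = \<iota> -` I + left_ideal_gen {q}"
proof
  obtain h where h: "\<iota> -` I = left_ideal_gen {h}"
    using poly_ideal_principal[OF left_ideal_vimage[OF I]] .
  have h0: "h \<noteq> 0"
    using nonzero by (auto simp: h left_ideal_gen_singleton)
  have hI: "\<iota> h \<in> I"
    using left_ideal_gen_superset[of "{h}"] by (auto simp flip: h)
  define g where "g = field_poly_gcd h q"
  obtain u v where u: "h = g * u" and v: "q = g * v"
    using field_poly_gcd(1,2)[of h q, folded g_def] by (elim dvdE)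
  have u0: "u \<noteq> 0" using u h0 by auto
  show "\<iota> -` (I + left_ideal_gen {\<iota> q}) \<subseteq> \<iota> -` I + left_ideal_gen {q}"
  proof
    fix p assume "p \<in> \<iota> -` (I + left_ideal_gen {\<iota> q})"
    then obtain i r where i: "i \<in> I" and p: "\<iota> p = i + r * \<iota> q"
      by (auto simp: left_ideal_gen_singleton elim!: set_plus_elim)
    have uq: "u * q = v * h"
      by (simp add: u v)
    have "\<iota> (u * p) = \<iota> u * i + \<iota> u * (r * \<iota> q)"
      by (simp add: central_embedding_mult p distrib_left)
    also have "\<iota> u * (r * \<iota> q) = r * \<iota> (u * q)"
      by (metis central_embedding_commute central_embedding_mult mult.assoc)
    also have "r * \<iota> (u * q) = (r * \<iota> v) * \<iota> h"
      by (simp add: uq central_embedding_mult mult.assoc)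
    finally have "\<iota> (u * p) \<in> I"
      using I i hI by (simp add: left_ideal_add left_ideal_mult)
    then have "u * p \<in> left_ideal_gen {h}"
      by (simp flip: h)
    then have "g dvd p"
      using u0 by (simp add: mem_left_ideal_gen_singleton_iff_dvd u mult.commute[of g])
    then have "p \<in> left_ideal_gen {h, q}"
      by (simp add: left_ideal_gen_pair_eq_gcd g_def mem_left_ideal_gen_singleton_iff_dvd)
    then show "p \<in> \<iota> -` I + left_ideal_gen {q}"
      by (simp add: left_ideal_gen_pair h)
  qed
  show "\<iota> -` I + left_ideal_gen {q} \<subseteq> \<iota> -` (I + left_ideal_gen {\<iota> q})"
    by (auto simp: left_ideal_gen_singleton central_embedding_add central_embedding_mult
        elim!: set_plus_elim intro!: set_plus_intro)
qed

end

section \<open>The ideal of the Bernstein-Sato polynomial\<close>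

lemma left_ideal_ann_fs: "left_ideal (ann_fs f)"
  by (simp add: left_ideal_def ann_fs_def ds_act_add ds_act_mult)

lemma vimage_ann_fs_plus_eq_bs_relation:
  "ds_upoly -` (ann_fs f + left_ideal_gen {ds_mpol f}) = {p. bs_relation f p}"
proof (intro set_eqI iffI)
  fix p assume "p \<in> ds_upoly -` (ann_fs f + left_ideal_gen {ds_mpol f})"
  then obtain A P where "ds_act f A 1 = 0" "ds_upoly p = A + P * ds_mpol f"
    by (auto simp: left_ideal_gen_singleton ann_fs_def elim!: set_plus_elim)
  then show "p \<in> {p. bs_relation f p}"
    by (auto simp: bs_relation_def ds_act_add)
next
  fix p assume "p \<in> {p. bs_relation f p}"
  then obtain P where P: "ds_act f (P * ds_mpol f) 1 = ds_act f (ds_upoly p) 1"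
    by (auto simp: bs_relation_def)
  have "ds_act f (ds_upoly p + - (P * ds_mpol f)) 1 = 0"
    unfolding ds_act_add ds_act_uminus P by simp
  then have "ds_upoly p + - (P * ds_mpol f) \<in> ann_fs f"
    by (simp only: ann_fs_def mem_Collect_eq)
  moreover have "P * ds_mpol f \<in> left_ideal_gen {ds_mpol f}"
    by (simp add: left_ideal_gen_singleton)
  ultimately have "(ds_upoly p + - (P * ds_mpol f)) + P * ds_mpol f
      \<in> ann_fs f + left_ideal_gen {ds_mpol f}"
    by (rule set_plus_intro)
  then show "p \<in> ds_upoly -` (ann_fs f + left_ideal_gen {ds_mpol f})"
    by simp
qed

text \<open>
  Minimality of the degree of \<open>b\<close> among the monic elements is minimality among all non-zero ones,
  as these can be divided by their leading coefficients.
\<close>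

lemma vimage_bernstein_ideal:
  fixes f :: "('n::linorder, 'k::field) mpol"
  assumes b: "is_bernstein_sato f b"
  shows "ds_upoly -` (ann_fs f + left_ideal_gen {ds_mpol f}) = left_ideal_gen {b}"
proof (rule left_ideal_eq_gen_of_min_degree)
  show "left_ideal (ds_upoly -` (ann_fs f + left_ideal_gen {ds_mpol f}))"
    by (intro left_ideal_vimage central_embedding_ds_upoly left_ideal_set_plus
        left_ideal_ann_fs left_ideal_left_ideal_gen)
  show "b \<in> ds_upoly -` (ann_fs f + left_ideal_gen {ds_mpol f})"
    using b by (simp add: vimage_ann_fs_plus_eq_bs_relation is_bernstein_sato_def)
  show "b \<noteq> 0"
    using b by (auto simp: is_bernstein_sato_def)
  fix p :: "'k poly"
  assume p: "p \<in> ds_upoly -` (ann_fs f + left_ideal_gen {ds_mpol f})" "p \<noteq> 0"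
  then have "bs_relation f ([:inverse (lead_coeff p):] * p)"
    unfolding vimage_ann_fs_plus_eq_bs_relation by (intro bs_relation_mult) simp
  moreover have "lead_coeff ([:inverse (lead_coeff p):] * p) = 1"
    using p(2) by simp
  ultimately have "degree b \<le> degree ([:inverse (lead_coeff p):] * p)"
    using b unfolding is_bernstein_sato_def by blast
  then show "degree b \<le> degree p"
    using p(2) by simp
qed

theorem theorem2p1:
  shows
    "(\<forall>(\<iota> :: 'k::field_char_0 poly \<Rightarrow> 'r::ring_1) (I :: 'r set) (q :: 'k poly).
        central_embedding \<iota> \<longrightarrow> left_ideal I \<longrightarrow> \<iota> -` I \<noteq> {0} \<longrightarrow>
          \<iota> -` (I + left_ideal_gen {\<iota> q}) = \<iota> -` I + left_ideal_gen {q} \<and>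
          \<iota> -` ideal_quot I (\<iota> q) = ideal_quot (\<iota> -` I) q \<and>
          \<iota> -` ideal_sat I (\<iota> q) = ideal_sat (\<iota> -` I) q) \<and>
     (\<forall>(f :: ('n::{finite,linorder}, 'k) mpol) (b :: 'k poly) (q :: 'k poly).
        f \<noteq> 0 \<longrightarrow> is_bernstein_sato f b \<longrightarrow>
          (ds_upoly -` (ann_fs f + left_ideal_gen {ds_mpol f, ds_upoly q}) = left_ideal_gen {b, q} \<and>
           left_ideal_gen {b, q} = left_ideal_gen {field_poly_gcd b q}) \<and>
          (ds_upoly -` ideal_quot (ann_fs f + left_ideal_gen {ds_mpol f}) (ds_upoly q) =
             ideal_quot (left_ideal_gen {b}) q \<and>
           ideal_quot (left_ideal_gen {b}) q = left_ideal_gen {b div field_poly_gcd b q}) \<and>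
          ds_upoly -` ideal_sat (ann_fs f + left_ideal_gen {ds_mpol f}) (ds_upoly q) =
            ideal_sat (left_ideal_gen {b}) q)"
proof (intro conjI allI impI)
  fix \<iota> :: "'k poly \<Rightarrow> 'r" and I :: "'r set" and q :: "'k poly"
  assume \<iota>: "central_embedding \<iota>" and I: "left_ideal I" "\<iota> -` I \<noteq> {0}"
  show "\<iota> -` (I + left_ideal_gen {\<iota> q}) = \<iota> -` I + left_ideal_gen {q}"
    by (rule vimage_plus_left_ideal_gen[OF \<iota> I])
  show "\<iota> -` ideal_quot I (\<iota> q) = ideal_quot (\<iota> -` I) q"
    by (rule vimage_ideal_quot[OF \<iota>])
  show "\<iota> -` ideal_sat I (\<iota> q) = ideal_sat (\<iota> -` I) q"
    by (rule vimage_ideal_sat[OF \<iota>])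
next
  fix f :: "('n, 'k) mpol" and b q :: "'k poly"
  assume b: "is_bernstein_sato f b"
  let ?I = "ann_fs f + left_ideal_gen {ds_mpol f}"
  note embedding = central_embedding_ds_upoly[where 'n = 'n and 'k = 'k]
  note I_b = vimage_bernstein_ideal[OF b]
  have b0: "b \<noteq> 0"
    using b by (auto simp: is_bernstein_sato_def)
  have I: "left_ideal ?I"
    by (intro left_ideal_set_plus left_ideal_ann_fs left_ideal_left_ideal_gen)
  have "b \<in> ds_upoly -` ?I"
    unfolding I_b using left_ideal_gen_superset[of "{b}"] by simp
  then have nonzero: "ds_upoly -` ?I \<noteq> {0}"
    using b0 by blast
  have "ann_fs f + left_ideal_gen {ds_mpol f, ds_upoly q} = ?I + left_ideal_gen {ds_upoly q}"
    by (simp only: left_ideal_gen_pair add.assoc)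
  then show "ds_upoly -` (ann_fs f + left_ideal_gen {ds_mpol f, ds_upoly q}) = left_ideal_gen {b, q}"
    using vimage_plus_left_ideal_gen[OF embedding I nonzero, of q]
    by (simp only: I_b left_ideal_gen_pair)
  show "left_ideal_gen {b, q} = left_ideal_gen {field_poly_gcd b q}"
    by (rule left_ideal_gen_pair_eq_gcd)
  show "ds_upoly -` ideal_quot ?I (ds_upoly q) = ideal_quot (left_ideal_gen {b}) q"
    by (simp only: vimage_ideal_quot[OF embedding] I_b)
  show "ideal_quot (left_ideal_gen {b}) q = left_ideal_gen {b div field_poly_gcd b q}"
    by (rule ideal_quot_principal[OF b0])
  show "ds_upoly -` ideal_sat ?I (ds_upoly q) = ideal_sat (left_ideal_gen {b}) q"
    by (simp only: vimage_ideal_sat[OF embedding] I_b)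
qed

end
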